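(* Let $(V,h)$ be a Euclidean vector space of dimension $n\ge4$. If $X\in\mathcal{MC}(V^* )$ satisfies $X\ast Y=0$ for all $Y\in\mathcal{MC}(V^* )$, then $X=0$.
   Context: $V$ is a finite-dimensional real vector space with positive definite symmetric bilinear form $h_{ij}$; indices are raised and lowered with $h$; brackets around indices denote complete antisymmetrization, normalized to be a projection. $\mathcal{MC}(V^* )=\{Y_{ijkl}\in\otimes^4V^*: Y_{[ij]kl}=Y_{ijkl}=Y_{ij[kl]},\ Y_{[ijk]l}=0\}$. For $X\in\mathcal{MC}(V^* )$, $\widehat X\in\operatorname{End}(\otimes^kV^* )$ is $\widehat X(\alpha)_{i_1\dots i_k}=\tfrac1k\sum_{r\ne s}X^{p}{}_{i_ri_s}{}^{q}\,\alpha_{i_1\dots p\dots q\dots i_k}$, the sum running over ordered pairs $(r,s)$ of distinct positions, with $p$ in position $r$ and $q$ in position $s$. The commutative multiplication on $\mathcal{MC}(V^* )$ is $X\ast Y:=\widehat X(Y)$. *)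

theory Defs
  imports "HOL-Analysis.Analysis" "HOL-Combinatorics.Permutations"
begin

text \<open>
  The Euclidean vector space \<open>(V, h)\<close> is a type \<open>'a\<close> of class \<open>euclidean_space\<close>, with \<open>h\<close> given
  by \<open>inner\<close>. An element of the \<open>k\<close>-fold tensor power of the dual space is a \<open>k\<close>-linear form,
  taking its arguments as a list of length \<open>k\<close>; the value on lists of any other length is set
  to zero, so that equality of tensors is equality of functions. Index positions count from 0.
\<close>

definition tensors :: "nat \<Rightarrow> ('a::euclidean_space list \<Rightarrow> real) set" where
  "tensors k = {\<alpha>.
     (\<forall>vs i. length vs = k \<longrightarrow> i < k \<longrightarrow> linear (\<lambda>x. \<alpha> (vs[i := x]))) \<and>
     (\<forall>vs. length vs \<noteq> k \<longrightarrow> \<alpha> vs = 0)}"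

text \<open>Complete antisymmetrization over the index positions in \<open>P\<close>, normalized to be a projection:\<close>

definition antisym :: "nat set \<Rightarrow> ('a list \<Rightarrow> real) \<Rightarrow> 'a list \<Rightarrow> real" where
  "antisym P \<alpha> vs =
     (\<Sum>\<sigma> | \<sigma> permutes P. of_int (sign \<sigma>) * \<alpha> (permute_list \<sigma> vs)) / fact (card P)"

definition MC :: "('a::euclidean_space list \<Rightarrow> real) set" where
  "MC = {Y \<in> tensors 4.
     antisym {0, 1} Y = Y \<and> antisym {2, 3} Y = Y \<and> antisym {0, 1, 2} Y = (\<lambda>_. 0)}"

text \<open>
  Since \<open>Basis\<close> is orthonormal with respect to \<open>inner\<close>, raising an index and contracting it
  with another one amounts to inserting the same basis vector in both positions and summing
  over \<open>Basis\<close>. The rank \<open>k\<close> is the number of arguments.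
\<close>

definition hat :: "('a::euclidean_space list \<Rightarrow> real) \<Rightarrow> ('a list \<Rightarrow> real) \<Rightarrow> 'a list \<Rightarrow> real" where
  "hat X \<alpha> vs = (let k = length vs in
     1 / real k * (\<Sum>(r, s) | r < k \<and> s < k \<and> r \<noteq> s.
       \<Sum>p\<in>Basis. \<Sum>q\<in>Basis. X [p, vs ! r, vs ! s, q] * \<alpha> (vs[r := p, s := q])))"

definition mc_mult ::
    "('a::euclidean_space list \<Rightarrow> real) \<Rightarrow> ('a list \<Rightarrow> real) \<Rightarrow> 'a list \<Rightarrow> real" (infixl "\<star>" 70) where
  "X \<star> Y = hat X Y"

end

theory Submission imports Defs begin

text \<open>
  For \<open>X\<close>, \<open>Y\<close> in \<open>MC\<close> the Ricci trace of \<open>X \<star> Y\<close> is half the sum of \<open>Y\<close> contracted with the Ricci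
  trace of \<open>X\<close> and \<open>X\<close> contracted with the Ricci trace of \<open>Y\<close>. Let \<open>a\<close>, \<open>b\<close>, \<open>c\<close> be orthonormal and
  take for \<open>Y\<close> the square of \<open>a \<and> b\<close>, whose Ricci trace is \<open>a \<otimes> a + b \<otimes> b\<close>. If \<open>X \<star> Y = 0\<close>, evaluation
  at \<open>(c, c)\<close> gives \<open>K(a, c) + K(b, c) = 0\<close> for the sectional curvatures of \<open>X\<close>. Permuting the three
  vectors yields \<open>K = 0\<close>, and the sectional curvature determines \<open>X\<close>.
\<close>

section \<open>Symmetries of the tensors in \<open>MC\<close>\<close>

lemma antisym_swap:
  fixes \<alpha> :: "'b list \<Rightarrow> real"
  assumes "a \<noteq> b"
  shows "antisym {a, b} \<alpha> vs = (\<alpha> vs - \<alpha> (permute_list (Transposition.transpose a b) vs)) / 2"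
  using assms
  by (simp add: antisym_def sum_over_permutations_insert sign_swap_id transpose_commute)

lemma antisym_first_pair:
  fixes \<alpha> :: "'b list \<Rightarrow> real"
  shows "antisym {0, 1} \<alpha> [x, y, z, w] = (\<alpha> [x, y, z, w] - \<alpha> [y, x, z, w]) / 2"
  by (simp add: antisym_swap permute_list_def numeral_eq_Suc Transposition.transpose_def)

lemma antisym_last_pair:
  fixes \<alpha> :: "'b list \<Rightarrow> real"
  shows "antisym {2, 3} \<alpha> [x, y, z, w] = (\<alpha> [x, y, z, w] - \<alpha> [x, y, w, z]) / 2"
  by (simp add: antisym_swap permute_list_def numeral_eq_Suc Transposition.transpose_def)

lemma antisym_first_three:
  fixes \<alpha> :: "'b list \<Rightarrow> real"
  shows "antisym {0, 1, 2} \<alpha> [x, y, z, w] =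
    (\<alpha> [x, y, z, w] + \<alpha> [y, z, x, w] + \<alpha> [z, x, y, w]
      - \<alpha> [y, x, z, w] - \<alpha> [x, z, y, w] - \<alpha> [z, y, x, w]) / 6"
  by (simp add: antisym_def sum_over_permutations_insert sign_compose permutation_swap_id
      sign_swap_id permute_list_def numeral_eq_Suc Transposition.transpose_def)

lemma list4E:
  assumes "length vs = 4"
  obtains x y z w where "vs = [x, y, z, w]"
  using assms by (auto simp: numeral_eq_Suc length_Suc_conv)

text \<open>Given antisymmetry in the first pair, the three odd permutations repeat the three even
  ones, so the six-term antisymmetrization collapses to the cyclic sum.\<close>

lemma MC_iff:
  fixes Y :: "'a::euclidean_space list \<Rightarrow> real"
  shows "Y \<in> MC \<longleftrightarrow> Y \<in> tensors 4
    \<and> (\<forall>x y z w. Y [y, x, z, w] = - Y [x, y, z, w])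
    \<and> (\<forall>x y z w. Y [x, y, w, z] = - Y [x, y, z, w])
    \<and> (\<forall>x y z w. Y [x, y, z, w] + Y [y, z, x, w] + Y [z, x, y, w] = 0)"
    (is "_ \<longleftrightarrow> _ \<and> ?first \<and> ?last \<and> ?bianchi")
proof (cases "Y \<in> tensors 4")
  case True
  \<comment> \<open>\<open>permute_list\<close> preserves length, so both sides vanish on lists of
    any other length and equality can be tested on four vectors.\<close>
  have zero: "antisym P Y vs = 0" "Y vs = 0" if "length vs \<noteq> 4" for P vs
    using True that by (simp_all add: antisym_def tensors_def)
  have eqI: "antisym P Y = g \<longleftrightarrow> (\<forall>x y z w. antisym P Y [x, y, z, w] = g [x, y, z, w])"
    if "\<And>vs. length vs \<noteq> 4 \<Longrightarrow> g vs = 0" for P g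
  proof (intro iffI ext)
    fix vs :: "'a list"
    assume *: "\<forall>x y z w. antisym P Y [x, y, z, w] = g [x, y, z, w]"
    show "antisym P Y vs = g vs"
      by (cases "length vs = 4") (use * zero that in \<open>auto elim!: list4E\<close>)
  qed auto
  have half: "(a - b) / 2 = a \<longleftrightarrow> b = - a" for a b :: real
    by auto
  have first: "antisym {0, 1} Y = Y \<longleftrightarrow> ?first"
    by (subst eqI, erule zero(2)) (simp only: antisym_first_pair half)
  have last: "antisym {2, 3} Y = Y \<longleftrightarrow> ?last"
    by (subst eqI, erule zero(2)) (simp only: antisym_last_pair half)
  have "antisym {0, 1, 2} Y = (\<lambda>_. 0) \<longleftrightarrow> ?bianchi" if ?first
  proof -
    have "antisym {0, 1, 2} Y [x, y, z, w] =
        (Y [x, y, z, w] + Y [y, z, x, w] + Y [z, x, y, w]) / 3" for x y z w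
      unfolding antisym_first_three
      using that[rule_format, of x y z w] that[rule_format, of y z x w]
        that[rule_format, of z x y w] by simp
    then show ?thesis
      by (subst eqI) auto
  qed
  with first last True show ?thesis
    unfolding MC_def mem_Collect_eq by blast
qed (simp add: MC_def)

lemma MC_first: "Y \<in> MC \<Longrightarrow> Y [y, x, z, w] = - Y [x, y, z, w]"
  and MC_last: "Y \<in> MC \<Longrightarrow> Y [x, y, w, z] = - Y [x, y, z, w]"
  and MC_Bianchi: "Y \<in> MC \<Longrightarrow> Y [x, y, z, w] + Y [y, z, x, w] + Y [z, x, y, w] = 0"
  for Y :: "'a::euclidean_space list \<Rightarrow> real"
  unfolding MC_iff by blast+

lemma MC_pair:
  fixes Y :: "'a::euclidean_space list \<Rightarrow> real"
  assumes "Y \<in> MC"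
  shows "Y [z, w, x, y] = Y [x, y, z, w]"
  \<comment> \<open>Each vector occupies the last slot of one Bianchi identity. The first two
    identities minus the last two leave
    \<open>2 * Y [x, y, z, w] - 2 * Y [z, w, x, y]\<close>.\<close>
  using MC_first[OF assms] MC_last[OF assms]
    MC_Bianchi[OF assms, of x y z w] MC_Bianchi[OF assms, of y z w x]
    MC_Bianchi[OF assms, of z w x y] MC_Bianchi[OF assms, of w x y z]
  by smt

lemma MC_reverse:
  fixes Y :: "'a::euclidean_space list \<Rightarrow> real"
  assumes "Y \<in> MC"
  shows "Y [w, z, y, x] = Y [x, y, z, w]"
  using MC_first[OF assms, of z w y x] MC_last[OF assms, of z w x y] MC_pair[OF assms, of z w x y]
  by simp

lemma MC_linear:
  fixes Y :: "'a::euclidean_space list \<Rightarrow> real"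
  assumes "Y \<in> MC"
  shows "linear (\<lambda>x. Y [x, y, z, w])" "linear (\<lambda>y. Y [x, y, z, w])"
    "linear (\<lambda>z. Y [x, y, z, w])" "linear (\<lambda>w. Y [x, y, z, w])"
proof -
  have "linear (\<lambda>t. Y (vs[i := t]))" if "length vs = 4" "i < 4" for vs i
    using assms that by (simp add: MC_def tensors_def)
  from this[of "[x, y, z, w]"]
  have *: "linear (\<lambda>t. Y ([x, y, z, w][i := t]))" if "i < 4" for i
    using that by simp
  show "linear (\<lambda>x. Y [x, y, z, w])" "linear (\<lambda>y. Y [x, y, z, w])"
    "linear (\<lambda>z. Y [x, y, z, w])" "linear (\<lambda>w. Y [x, y, z, w])"
    using *[of 0] *[of 1] *[of 2] *[of 3] by (simp_all add: numeral_eq_Suc)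
qed

section \<open>The product in rank four and its Ricci trace\<close>

lemma hat_rank4:
  fixes X Y :: "'a::euclidean_space list \<Rightarrow> real"
  assumes rev: "\<And>x y z w. X [w, z, y, x] = X [x, y, z, w]"
  shows "hat X Y [a, b, c, d] = (\<Sum>p\<in>Basis. \<Sum>q\<in>Basis.
      X [p, a, b, q] * Y [p, q, c, d] + X [p, a, c, q] * Y [p, b, q, d]
    + X [p, a, d, q] * Y [p, b, c, q] + X [p, b, c, q] * Y [a, p, q, d]
    + X [p, b, d, q] * Y [a, p, c, q] + X [p, c, d, q] * Y [a, b, p, q]) / 2"
proof -
  define vs where "vs = [a, b, c, d]"
  have len: "length vs = 4" by (simp add: vs_def)
  define T where "T r s =
    (\<Sum>p\<in>Basis. \<Sum>q\<in>Basis. X [p, vs ! r, vs ! s, q] * Y (vs[r := p, s := q]))" for r s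
  \<comment> \<open>Exchanging \<open>p\<close> and \<open>q\<close> reverses the arguments of
    \<open>X\<close>, so \<open>(r, s)\<close> and \<open>(s, r)\<close> contribute equally: twelve
    terms become six, and the factor 1/4 becomes 1/2.\<close>
  have sym: "T r s = T s r" if "r \<noteq> s" for r s
    unfolding T_def
    by (subst sum.swap, rule sum.cong[OF refl], rule sum.cong[OF refl])
       (simp add: rev list_update_swap[OF that])
  have set: "{(r, s). r < 4 \<and> s < 4 \<and> r \<noteq> s} =
    {(0,1), (1,0), (0,2), (2,0), (0,3), (3,0), (1,2), (2,1), (1,3), (3,1), (2,3), (3,2::nat)}"
    by (auto simp: less_Suc_eq numeral_eq_Suc)
  have "hat X Y vs = 1/4 * (\<Sum>(r, s) | r < 4 \<and> s < 4 \<and> r \<noteq> s. T r s)"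
    by (simp add: hat_def T_def len)
  also have "\<dots> = (T 0 1 + T 0 2 + T 0 3 + T 1 2 + T 1 3 + T 2 3) / 2"
    unfolding set using sym by simp
  finally show ?thesis
    by (simp add: T_def vs_def sum.distrib numeral_eq_Suc)
qed

lemma sum_rotate3:
  "(\<Sum>x\<in>A. \<Sum>y\<in>B. \<Sum>z\<in>C. f x y z) = (\<Sum>z\<in>C. \<Sum>x\<in>A. \<Sum>y\<in>B. f x y z)"
  by (subst (2) sum.swap, subst sum.swap) simp

text \<open>The four terms in which exactly one traced slot is hit cancel in pairs.\<close>

lemma trace_hat:
  fixes X Y :: "'a::euclidean_space list \<Rightarrow> real"
  assumes X: "X \<in> MC"
  shows "(\<Sum>e\<in>Basis. hat X Y [e, u, v, e]) = (\<Sum>p\<in>Basis. \<Sum>q\<in>Basis.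
      (\<Sum>e\<in>Basis. X [p, e, e, q]) * Y [p, u, v, q]
    + X [p, u, v, q] * (\<Sum>e\<in>Basis. Y [e, p, q, e])) / 2"
proof -
  \<comment> \<open>The sign behind the cancellation: cyclic renaming of the summed vectors carries
    the term for positions 1 and 3 to that for 0 and 1, and the term for 2 and 3 to that for 0 and
    2, each with this sign.\<close>
  have flip: "X [q, u, p, e] = - X [p, e, u, q]" for p q e u
    using MC_pair[OF X, of p e q u] MC_last[OF X, of p e q u] by simp
  let ?S = "\<lambda>f. \<Sum>e\<in>(Basis :: 'a set). \<Sum>p\<in>(Basis :: 'a set). \<Sum>q\<in>(Basis :: 'a set). f e p q :: real"
  have rot: "?S f = ?S (\<lambda>e p q. f p q e)" for f
    by (rule sum_rotate3)
  have c1: "?S (\<lambda>e p q. X [p, u, e, q] * Y [e, p, v, q]) =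
      - ?S (\<lambda>e p q. X [p, e, u, q] * Y [p, q, v, e])"
    unfolding sum_negf[symmetric] by (subst rot, intro sum.cong refl, subst flip) simp
  have c2: "?S (\<lambda>e p q. X [p, v, e, q] * Y [e, u, p, q]) =
      - ?S (\<lambda>e p q. X [p, e, v, q] * Y [p, u, q, e])"
    unfolding sum_negf[symmetric] by (subst rot, intro sum.cong refl, subst flip) simp
  \<comment> \<open>\<open>X\<close> acting on both traced positions yields its own Ricci trace;
    acting on the two free positions, it meets the Ricci trace of \<open>Y\<close>.\<close>
  have r1: "?S (\<lambda>e p q. X [p, e, e, q] * Y [p, u, v, q]) =
      (\<Sum>p\<in>Basis. \<Sum>q\<in>Basis. (\<Sum>e\<in>Basis. X [p, e, e, q]) * Y [p, u, v, q])"
    by (subst sum_rotate3[symmetric]) (simp only: sum_distrib_right)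
  have r2: "?S (\<lambda>e p q. X [p, u, v, q] * Y [e, p, q, e]) =
      (\<Sum>p\<in>Basis. \<Sum>q\<in>Basis. X [p, u, v, q] * (\<Sum>e\<in>Basis. Y [e, p, q, e]))"
    by (subst sum_rotate3[symmetric]) (simp only: sum_distrib_left)
  show ?thesis
    unfolding hat_rank4[of X, OF MC_reverse[OF X]] sum_divide_distrib[symmetric]
    by (simp only: sum.distrib c1 c2 r1 r2) simp
qed

section \<open>Squares of decomposable two-forms as test tensors\<close>

definition wedge :: "'a::euclidean_space \<Rightarrow> 'a \<Rightarrow> 'a \<Rightarrow> 'a \<Rightarrow> real" where
  "wedge a b x y = (a \<bullet> x) * (b \<bullet> y) - (a \<bullet> y) * (b \<bullet> x)"

text \<open>The last two arguments enter in reversed order so that contracting positions 0 and 3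
  gives a positive semidefinite Ricci trace.\<close>

definition wedge_square :: "'a::euclidean_space \<Rightarrow> 'a \<Rightarrow> 'a list \<Rightarrow> real" where
  "wedge_square a b vs = (if length vs = 4
     then wedge a b (vs ! 0) (vs ! 1) * wedge a b (vs ! 3) (vs ! 2) else 0)"

lemma wedge_square_nth [simp]:
  "wedge_square a b [x, y, z, w] = wedge a b x y * wedge a b w z"
  by (simp add: wedge_square_def numeral_eq_Suc)

text \<open>The Bianchi identity is the Pluecker relation: a decomposable two-form has exterior
  square zero.\<close>

lemma wedge_square_MC: "wedge_square a b \<in> MC"
proof -
  have "linear (\<lambda>t. wedge_square a b (vs[i := t]))" if vs: "length vs = 4" and i: "i < 4" for vs i
  proof -
    obtain x y z w where [simp]: "vs = [x, y, z, w]" using vs by (rule list4E)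
    consider "i = 0" | "i = 1" | "i = 2" | "i = 3" using i by linarith
    then show ?thesis
      by cases (auto simp: numeral_eq_Suc wedge_def algebra_simps intro!: linearI)
  qed
  then have "wedge_square a b \<in> tensors 4"
    by (auto simp: tensors_def wedge_square_def)
  then show ?thesis
    by (auto simp: MC_iff wedge_def algebra_simps)
qed

lemma sum_Basis_inner_mult:
  fixes f :: "'a::euclidean_space \<Rightarrow> real"
  assumes "linear f"
  shows "(\<Sum>p\<in>Basis. (a \<bullet> p) * f p) = f a"
proof -
  have "f a = f (\<Sum>p\<in>Basis. (a \<bullet> p) *\<^sub>R p)"
    by (simp add: euclidean_representation)
  also have "\<dots> = (\<Sum>p\<in>Basis. (a \<bullet> p) * f p)"
    by (simp add: linear_sum[OF assms] linear_cmul[OF assms])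
  finally show ?thesis ..
qed

lemma trace_wedge_square:
  fixes a b :: "'a::euclidean_space"
  assumes "a \<bullet> b = 0"
  shows "(\<Sum>e\<in>Basis. wedge_square a b [e, p, q, e]) =
    (a \<bullet> a) * ((b \<bullet> p) * (b \<bullet> q)) + (b \<bullet> b) * ((a \<bullet> p) * (a \<bullet> q))"
proof -
  \<comment> \<open>\<open>U t\<close> represents the linear form
    \<open>\<lambda>e. wedge a b e t\<close>, which turns the trace into a Parseval sum.\<close>
  define U where "U t = (b \<bullet> t) *\<^sub>R a - (a \<bullet> t) *\<^sub>R b" for t
  have "wedge a b e t = U t \<bullet> e" for e t
    by (simp add: wedge_def U_def inner_diff_left mult.commute)
  then have "(\<Sum>e\<in>Basis. wedge_square a b [e, p, q, e]) = U p \<bullet> U q"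
    by (simp add: euclidean_inner[of "U p" "U q"])
  also have "\<dots> = (a \<bullet> a) * ((b \<bullet> p) * (b \<bullet> q)) + (b \<bullet> b) * ((a \<bullet> p) * (a \<bullet> q))"
    using assms by (simp add: U_def inner_diff_left inner_diff_right inner_commute algebra_simps)
  finally show ?thesis .
qed

lemma sum_Basis_bilinear:
  fixes X :: "'a::euclidean_space list \<Rightarrow> real"
  assumes X: "X \<in> MC"
  shows "(\<Sum>p\<in>Basis. \<Sum>q\<in>Basis. X [p, u, v, q] * ((a \<bullet> p) * (a \<bullet> q))) = X [a, u, v, a]"
proof -
  have "(\<Sum>q\<in>Basis. X [p, u, v, q] * ((a \<bullet> p) * (a \<bullet> q))) =
      (a \<bullet> p) * (\<Sum>q\<in>Basis. (a \<bullet> q) * X [p, u, v, q])" for p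
    unfolding sum_distrib_left by (intro sum.cong refl) simp
  then show ?thesis
    by (simp only: sum_Basis_inner_mult[OF MC_linear(4)[OF X]]
        sum_Basis_inner_mult[OF MC_linear(1)[OF X]])
qed

text \<open>Evaluating the trace at a vector orthogonal to \<open>a\<close> and \<open>b\<close> kills the term involving the
  Ricci trace of \<open>X\<close>.\<close>

lemma sectional_relation:
  fixes X :: "'a::euclidean_space list \<Rightarrow> real"
  assumes X: "X \<in> MC" and ann: "\<And>Y. Y \<in> MC \<Longrightarrow> X \<star> Y = (\<lambda>_. 0)"
    and "a \<bullet> b = 0" "a \<bullet> c = 0" "b \<bullet> c = 0"
  shows "(a \<bullet> a) * X [b, c, c, b] + (b \<bullet> b) * X [a, c, c, a] = 0"
proof -
  have "wedge a b p c = 0" for p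
    using assms by (simp add: wedge_def)
  then have "0 = (\<Sum>p\<in>Basis. \<Sum>q\<in>Basis.
      X [p, c, c, q] * (\<Sum>e\<in>Basis. wedge_square a b [e, p, q, e]))"
    using trace_hat[OF X, of "wedge_square a b" c c] ann[OF wedge_square_MC]
    by (simp add: mc_mult_def)
  also have "\<dots> = (\<Sum>p\<in>Basis. \<Sum>q\<in>Basis.
      (a \<bullet> a) * (X [p, c, c, q] * ((b \<bullet> p) * (b \<bullet> q)))
    + (b \<bullet> b) * (X [p, c, c, q] * ((a \<bullet> p) * (a \<bullet> q))))"
    unfolding trace_wedge_square[OF assms(3)]
    by (intro sum.cong refl) (simp add: algebra_simps)
  also have "\<dots> = (a \<bullet> a) * X [b, c, c, b] + (b \<bullet> b) * X [a, c, c, a]"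
    by (simp add: sum.distrib sum_Basis_bilinear[OF X] flip: sum_distrib_left)
  finally show ?thesis by simp
qed

section \<open>Recovering the tensor from its sectional curvatures\<close>

lemma MC_zero_if_sectional_zero:
  fixes X :: "'a::euclidean_space list \<Rightarrow> real"
  assumes X: "X \<in> MC" and K: "\<And>x y. X [x, y, y, x] = 0"
  shows "X = (\<lambda>_. 0)"
proof
  fix vs
  note lin = MC_linear[OF X, THEN linear_add]
  \<comment> \<open>Polarization in the middle vector; the two mixed terms agree by
    reversal.\<close>
  have 1: "X [x, y, z, x] = 0" for x y z
    using K[of x "y + z"] K[of x y] K[of x z] MC_reverse[OF X, of x z y x]
    by (simp add: lin)
  \<comment> \<open>Polarization in the outer vector; reversal rewrites the second mixed
    term.\<close>
  have 2: "X [x, z, y, w] = - X [x, y, z, w]" for x y z w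
    using 1[of "x + w" y z] 1[of x y z] 1[of w y z] MC_reverse[OF X, of x z y w]
    by (simp add: lin)
  \<comment> \<open>\<open>X\<close> now alternates in its first three arguments, so its Bianchi sum
    is three times \<open>X\<close>.\<close>
  have "X [x, y, z, w] = 0" for x y z w
    using MC_Bianchi[OF X, of x y z w] MC_first[OF X] 2 by smt
  moreover have "X vs = 0" if "length vs \<noteq> 4"
    using X that by (simp add: MC_def tensors_def)
  ultimately show "X vs = 0"
    by (metis list4E)
qed

theorem theorem7p10:
  fixes X :: "'a::euclidean_space list \<Rightarrow> real"
  assumes "DIM('a) \<ge> 4"
    and "X \<in> MC"
    and "\<And>Y. Y \<in> MC \<Longrightarrow> X \<star> Y = (\<lambda>_. 0)"
  shows "X = (\<lambda>_. 0)"
proof (rule MC_zero_if_sectional_zero[OF assms(2)])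
  note X = assms(2)
  have sec: "X [a, c, c, a] = 0" if ac: "a \<bullet> c = 0" for a c
  proof (cases "c = 0")
    case True
    then show ?thesis using linear_0[OF MC_linear(2)[OF X]] by simp
  next
    case False
    \<comment> \<open>Since \<open>a\<close> and \<open>c\<close> span at most a plane, a nonzero
      \<open>b\<close> orthogonal to both exists.\<close>
    have "dim {a, c} \<le> card {a, c}" by (rule dim_le_card') simp
    also have "\<dots> < DIM('a)" using assms(1) card_insert_le_m1[of 2 "{c}" a] by simp
    finally obtain b where b: "b \<noteq> 0" "\<And>y. y \<in> span {a, c} \<Longrightarrow> orthogonal b y"
      using orthogonal_to_subspace_exists by blast
    then have "b \<bullet> a = 0" "b \<bullet> c = 0"
      by (auto simp: orthogonal_def span_base)
    note perp = this ac
    note rel = sectional_relation[OF X assms(3)]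
    \<comment> \<open>Squared norms replace normalization. The first relation plus the second minus
      the third is twice \<open>(b \<bullet> b) * X [a, c, c, a]\<close>.\<close>
    have "(a \<bullet> a) * X [b, c, c, b] + (b \<bullet> b) * X [a, c, c, a] = 0"
      "(b \<bullet> b) * X [a, c, c, a] + (c \<bullet> c) * X [a, b, b, a] = 0"
      "(a \<bullet> a) * X [b, c, c, b] + (c \<bullet> c) * X [a, b, b, a] = 0"
      using rel[of a b c] rel[of b c a] rel[of a c b] perp
        MC_pair[OF X, of a c c a] MC_pair[OF X, of a b b a] MC_pair[OF X, of b c c b]
      by (auto simp: inner_commute)
    then have "(b \<bullet> b) * X [a, c, c, a] = 0" by linarith
    then show ?thesis using b(1) by simp
  qed
  fix x y :: 'a
  show "X [x, y, y, x] = 0"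
  proof (cases "x = 0")
    case True
    then show ?thesis using linear_0[OF MC_linear(1)[OF X]] by simp
  next
    case False
    \<comment> \<open>Gram-Schmidt: \<open>z\<close> is the part of \<open>y\<close> orthogonal to
      \<open>x\<close>, and the part along \<open>x\<close> drops out by antisymmetry within each
      pair.\<close>
    define t where "t = (x \<bullet> y) / (x \<bullet> x)"
    define z where "z = y - t *\<^sub>R x"
    have "x \<bullet> z = 0" using False by (simp add: z_def t_def inner_diff_right)
    moreover have "y = z + t *\<^sub>R x" by (simp add: z_def)
    moreover have "X [x, x, u, v] = 0" "X [u, v, x, x] = 0" for u v
      using MC_first[OF X, of x x u v] MC_last[OF X, of u v x x] by simp_all
    ultimately show ?thesis
      using sec[of x z]
      by (simp add: MC_linear[OF X, THEN linear_add] MC_linear[OF X, THEN linear_cmul])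
  qed
qed

end
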